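(* Let $k = \left(\frac{3}{2}\right)^{2/3}$ and $l = \frac{1}{2}\left(\frac{3}{2}\right)^{1/3}$. There exist constants $c_1,c_2,c_3\in\mathbb{R}$ and an $n_0$ such that for all $n\ge n_0$, and for any initial rotor configuration and any choice of rotor sequences on the comb $\mathcal{C}_2$, the rotor-router cluster $R_n$ of $n$ particles on $\mathcal{C}_2$ satisfies $$\tilde{\mathcal{B}}_n\subset R_n,$$ where $$\tilde{\mathcal{B}}_n=\Big\{(x,y)\in\mathcal{C}_2:\ |x|\le k n^{1/3}-c_1 n^{1/6},\ \ |y|\le l\Big(n^{1/3}-\frac{|x|}{k}\Big)^2+c_2|x|-c_3 n^{1/3}\Big\}.$$
   Context: The comb $\mathcal{C}_2$ is the graph with vertex set $\mathbb{Z}^2$ (vertices written $(x,y)$) obtained from the square lattice $\mathbb{Z}^2$ by deleting all horizontal edges except those on the $x$-axis. Thus $(x,y)\sim(x,y\pm1)$ for all $x,y$, and $(x,0)\sim(x\pm1,0)$ for all $x$. The origin is $o=(0,0)$, and $d(z)$ denotes the degree of $z$. Rotor-router walk: for each vertex $z$ fix a cyclic ordering $c(z)=(z_0,\dots,z_{d(z)-1})$ of its neighbours, called the rotor sequence of $z$. A rotor configuration is a map $\rho$ assigning to each vertex one of its neighbours. A particle at $z$ with current rotor $\rho(z)=z_i$ makes one step by first changing the rotor to $\rho(z)=z_{i+1}$ (index modulo $d(z)$) and then moving to $z_{i+1}$. Rotor-router aggregation: starting from an initial rotor configuration, set $R_1=\{o\}$, and for $i\ge2$ set $R_i=R_{i-1}\cup\{z_i\}$,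 where $z_i$ is the first vertex outside $R_{i-1}$ visited by a particle performing a rotor-router walk started at $o$. The particle stops at $z_i$, and the next particle starts at $o$ without resetting the rotors. $R_n$ is the rotor-router cluster of $n$ particles. *)

theory Defs
  imports Complex_Main
begin

section \<open>Rotor-router walk and aggregation\<close>

text \<open>
  A graph is given by its adjacency relation. A rotor sequence of a vertex is represented by a
  list enumerating its neighbours without repetition, read cyclically; lists differing by a
  rotation represent the same cyclic ordering and give the same walk.
\<close>

definition rotor_sequences :: "('v \<Rightarrow> 'v \<Rightarrow> bool) \<Rightarrow> ('v \<Rightarrow> 'v list) \<Rightarrow> bool" where
  "rotor_sequences adj c \<longleftrightarrow> (\<forall>z. distinct (c z) \<and> set (c z) = {w. adj z w})"

definition rotor_configuration :: "('v \<Rightarrow> 'v \<Rightarrow> bool) \<Rightarrow> ('v \<Rightarrow> 'v) \<Rightarrow> bool" where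
  "rotor_configuration adj \<rho> \<longleftrightarrow> (\<forall>z. adj z (\<rho> z))"

definition cyclic_next :: "'v list \<Rightarrow> 'v \<Rightarrow> 'v" where
  "cyclic_next zs w = zs ! (Suc (THE i. i < length zs \<and> zs ! i = w) mod length zs)"

text \<open>The state of a walk consists of the position of the particle and the rotor configuration.\<close>

definition rotor_step :: "('v \<Rightarrow> 'v list) \<Rightarrow> 'v \<times> ('v \<Rightarrow> 'v) \<Rightarrow> 'v \<times> ('v \<Rightarrow> 'v)" where
  "rotor_step c = (\<lambda>(z, \<rho>).
     let w = cyclic_next (c z) (\<rho> z) in (w, \<rho>(z := w)))"

definition rotor_walk ::
  "('v \<Rightarrow> 'v list) \<Rightarrow> 'v \<Rightarrow> ('v \<Rightarrow> 'v) \<Rightarrow> nat \<Rightarrow> 'v \<times> ('v \<Rightarrow> 'v)" where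
  "rotor_walk c z \<rho> t = (rotor_step c ^^ t) (z, \<rho>)"

text \<open>
  On an infinite connected locally finite graph every rotor-router walk leaves every finite set,
  so the minimum below is attained for all the sets \<open>R\<close> arising in the aggregation.
\<close>

definition exit_time :: "('v \<Rightarrow> 'v list) \<Rightarrow> 'v \<Rightarrow> 'v set \<Rightarrow> ('v \<Rightarrow> 'v) \<Rightarrow> nat" where
  "exit_time c z R \<rho> = (LEAST t. fst (rotor_walk c z \<rho> t) \<notin> R)"

text \<open>
  \<open>aggregation c z \<rho> n\<close> is the cluster of \<open>n\<close> particles with source \<open>z\<close>, together with the
  rotor configuration left behind by them. The first particle occupies \<open>z\<close> without moving
  any rotor.
\<close>

fun aggregation ::
  "('v \<Rightarrow> 'v list) \<Rightarrow> 'v \<Rightarrow> ('v \<Rightarrow> 'v) \<Rightarrow> nat \<Rightarrow> 'v set \<times> ('v \<Rightarrow> 'v)" where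
  "aggregation c z \<rho> 0 = ({}, \<rho>)"
| "aggregation c z \<rho> (Suc 0) = ({z}, \<rho>)"
| "aggregation c z \<rho> (Suc (Suc n)) =
     (let (R, \<rho>') = aggregation c z \<rho> (Suc n);
          (w, \<rho>'') = rotor_walk c z \<rho>' (exit_time c z R \<rho>')
      in (insert w R, \<rho>''))"

definition cluster :: "('v \<Rightarrow> 'v list) \<Rightarrow> 'v \<Rightarrow> ('v \<Rightarrow> 'v) \<Rightarrow> nat \<Rightarrow> 'v set" where
  "cluster c z \<rho> n = fst (aggregation c z \<rho> n)"


section \<open>The comb\<close>

fun comb_adj :: "int \<times> int \<Rightarrow> int \<times> int \<Rightarrow> bool" where
  "comb_adj (x, y) (x', y') \<longleftrightarrow>
     (x' = x \<and> \<bar>y' - y\<bar> = 1) \<or> (y = 0 \<and> y' = 0 \<and> \<bar>x' - x\<bar> = 1)"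

definition comb_k :: real where
  "comb_k = (3 / 2) powr (2 / 3)"

definition comb_l :: real where
  "comb_l = 1 / 2 * (3 / 2) powr (1 / 3)"

definition inner_set :: "real \<Rightarrow> real \<Rightarrow> real \<Rightarrow> nat \<Rightarrow> (int \<times> int) set" where
  "inner_set c1 c2 c3 n = {(x, y).
     \<bar>real_of_int x\<bar> \<le> comb_k * real n powr (1 / 3) - c1 * real n powr (1 / 6) \<and>
     \<bar>real_of_int y\<bar> \<le> comb_l * (real n powr (1 / 3) - \<bar>real_of_int x\<bar> / comb_k)\<^sup>2
       + c2 * \<bar>real_of_int x\<bar> - c3 * real n powr (1 / 3)}"

end

theory Submission
  imports Defs "HOL-Library.Infinite_Set"
begin

text \<open>
  The comb is a tree, so the number of particles of the final cluster that lie beyond an edge is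
  exactly the net number of rotor moves across that edge. Let \<open>u\<close> be the odometer, the
  number of moves made from each vertex. Since the rotors are used cyclically, a vertex \<open>z\<close>
  sends \<open>u z / d z\<close> particles to each of its neighbours, up to an error of at most one. Hence
  the difference of \<open>u / d\<close> along an edge is the number of particles beyond it, up to an error
  of at most two, for every choice of rotors (\<open>flow_near_odometer_difference\<close>). This
  determines the shape of the cluster up to constants.

  On a tooth with \<open>h\<close> occupied vertices, summing these relations from the tip gives
  \<open>u (x, y) = (h - \<bar>y\<bar>)\<^sup>2 + O(h)\<close>, and at the base
  \<open>u (x, 0) / 2 = h\<^sup>2 + O(h)\<close>. So both teeth at \<open>x\<close> have height
  \<open>q = sqrt (u (x, 0) / 2)\<close> up to an additive constant (\<open>tooth_height\<close>).

  On one half of the spine, let \<open>b\<close> be the last occupied position, \<open>r = b - \<bar>x\<bar>\<close>, and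
  \<open>T r\<close> the number of particles in the columns at distance at most \<open>r\<close> from the tip. Then
  \<open>q\<^sup>2\<close> grows by \<open>2 T + O(1)\<close> and \<open>T\<close> grows by \<open>2 q + O(1)\<close> per step. This is a
  discretization of \<open>q q' = T\<close>, \<open>T' = 2 q\<close>, which is solved by \<open>q = r\<^sup>2 / 3\<close>,
  \<open>T = 2 r\<^sup>3 / 9\<close>. Explicit super- and subsolutions
  (\<open>spine_recurrence_upper\<close>, \<open>spine_recurrence_lower\<close>) show that the bounded errors only
  amount to a bounded shift of \<open>r\<close>.

  The value of \<open>q\<close> at the origin is common to both halves, so their lengths differ by a bounded
  amount. Counting all particles gives \<open>n \<le> 4 (b + O(1))\<^sup>3 / 9\<close>, that is,
  \<open>b \<ge> k n powr (1 / 3) - O(1)\<close> because \<open>k\<^sup>3 = 9 / 4\<close> (\<open>cluster_size_le\<close>). Finally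
  \<open>l = k\<^sup>2 / 3\<close>, so that with \<open>N = n powr (1 / 3)\<close> the bound in the theorem is
  \<open>(k N - \<bar>x\<bar>)\<^sup>2 / 3\<close> up to lower order terms. A bounded shift inside the square costs
  \<open>O(N)\<close>, which the term with \<open>c3\<close> absorbs (\<open>inner_set_subset\<close>).
\<close>

section \<open>Rotors at a single vertex\<close>

text \<open>
  The number of times the rotor points to \<open>w\<close> during its first \<open>u\<close> moves from position \<open>r\<close>.
  A particle leaves along the rotor after moving it, hence the successor in the exponent.
\<close>
definition sent :: "'v list \<Rightarrow> 'v \<Rightarrow> nat \<Rightarrow> 'v \<Rightarrow> nat" where
  "sent zs r u w = card {t. t < u \<and> (cyclic_next zs ^^ Suc t) r = w}"

lemma sent_0 [simp]: "sent zs r 0 w = 0"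
  by (simp add: sent_def)

lemma sent_Suc:
  "sent zs r (Suc u) w = sent zs r u w + (if (cyclic_next zs ^^ Suc u) r = w then 1 else 0)"
proof -
  have "{t. t < Suc u \<and> (cyclic_next zs ^^ Suc t) r = w} =
        {t. t < u \<and> (cyclic_next zs ^^ Suc t) r = w} \<union>
        (if (cyclic_next zs ^^ Suc u) r = w then {u} else {})"
    by (auto simp: less_Suc_eq)
  then show ?thesis
    unfolding sent_def by (simp add: card_insert_if)
qed

lemma cyclic_next_nth:
  assumes "distinct zs" "i < length zs"
  shows "cyclic_next zs (zs ! i) = zs ! (Suc i mod length zs)"
proof -
  have "(THE i'. i' < length zs \<and> zs ! i' = zs ! i) = i"
    using assms by (intro the_equality) (auto simp: nth_eq_iff_index_eq)
  then show ?thesis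
    by (simp add: cyclic_next_def)
qed

lemma cyclic_next_funpow_nth:
  assumes "distinct zs" "i < length zs"
  shows "(cyclic_next zs ^^ t) (zs ! i) = zs ! ((i + t) mod length zs)"
proof (induction t)
  case (Suc t)
  have "(i + t) mod length zs < length zs"
    using assms by (intro mod_less_divisor) auto
  with Suc show ?case
    by (simp add: cyclic_next_nth assms mod_Suc_eq)
qed (use assms in simp)

lemma cyclic_next_funpow_in_set:
  assumes "distinct zs" "r \<in> set zs"
  shows "(cyclic_next zs ^^ t) r \<in> set zs"
proof -
  obtain i where i: "i < length zs" "r = zs ! i"
    using assms(2) by (auto simp: in_set_conv_nth)
  then have "(i + t) mod length zs < length zs"
    by (intro mod_less_divisor) auto
  then show ?thesis
    using i assms(1) by (simp add: cyclic_next_funpow_nth)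
qed

text \<open>
  A rotor moved often enough returns to each neighbour after any given number of moves; this drives
  the recurrence argument for walks in finite sets.
\<close>
lemma cyclic_next_hits:
  assumes "distinct zs" "r \<in> set zs" "w \<in> set zs"
  shows "\<exists>k\<ge>m. (cyclic_next zs ^^ Suc k) r = w"
proof -
  obtain i j where i: "i < length zs" "r = zs ! i" and j: "j < length zs" "w = zs ! j"
    using assms by (auto simp: in_set_conv_nth)
  define d where "d = length zs"
  \<comment> \<open>This number of further moves leads from entry \<open>i\<close> to entry \<open>j\<close> and is at least \<open>m\<close>.\<close>
  define k where "k = j + (d - i) + m * d + (d - 1)"
  have "i + Suc k = j + (m + 2) * d"
    using i unfolding k_def d_def by (auto simp: algebra_simps)
  then have "(i + Suc k) mod d = j"
    using j unfolding d_def by (metis mod_less mod_mult_self1)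
  then have "(cyclic_next zs ^^ Suc k) r = w"
    using cyclic_next_funpow_nth[OF assms(1) i(1), of "Suc k"] i(2) j(2) d_def by metis
  moreover have "m \<le> m * d"
    using i d_def by (cases d) auto
  then have "m \<le> k"
    unfolding k_def by linarith
  ultimately show ?thesis by blast
qed

text \<open>
  The quotient jumps exactly when the shifted argument reaches a multiple of \<open>d\<close>.
\<close>
lemma div_mod_Suc_shift:
  fixes d a u j :: int
  assumes "d > 0" "0 \<le> j" "j < d"
  shows "(u + 1 + (a - j) mod d) div d =
         (u + (a - j) mod d) div d + (if (a + u + 1) mod d = j then 1 else 0)"
proof -
  define v where "v = u + (a - j) mod d"
  define q where "q = v div d"
  define r where "r = v mod d"
  have v: "v = d * q + r" and r: "0 \<le> r" "r < d"
    using assms(1) by (auto simp: q_def r_def)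
  have *: "(v + 1) div d = q + (if (v + 1) mod d = 0 then 1 else 0)"
  proof (cases "r = d - 1")
    case True
    then have "v + 1 = d * (q + 1)" using v by (simp add: algebra_simps)
    then show ?thesis using assms(1) by simp
  next
    case False
    then have "v + 1 = d * q + (r + 1)" "0 \<le> r + 1" "r + 1 < d" using v r by auto
    from int_div_pos_eq[OF this] int_mod_pos_eq[OF this] r show ?thesis by simp
  qed
  have "(v + 1) mod d = (a + u + 1 - j) mod d"
    using mod_add_right_eq[of "u + 1" "a - j" d] by (simp add: v_def algebra_simps)
  moreover have "(a + u + 1 - j) mod d = 0 \<longleftrightarrow> (a + u + 1) mod d = j mod d"
    by (simp add: mod_eq_dvd_iff mod_eq_0_iff_dvd)
  ultimately have "(v + 1) mod d = 0 \<longleftrightarrow> (a + u + 1) mod d = j"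
    using assms by simp
  moreover have "u + 1 + (a - j) mod d = v + 1"
    by (simp add: v_def)
  ultimately show ?thesis
    using * by (simp only: q_def v_def)
qed

text \<open>
  The rotor points to entry \<open>j\<close> exactly when \<open>i + u\<close> is congruent to \<open>j\<close>, so the count is a
  floor of \<open>u\<close> divided by the degree, with an offset that depends only on \<open>i\<close> and \<open>j\<close>.
\<close>
lemma sent_closed_form:
  assumes "distinct zs" "i < length zs" "j < length zs"
  shows "int (sent zs (zs ! i) u (zs ! j)) =
         (int u + (int i - int j) mod int (length zs)) div int (length zs)"
proof (induction u)
  case 0
  have "length zs > 0" using assms by linarith
  then show ?case by simp
next
  case (Suc u)
  let ?d = "length zs"
  have d: "?d > 0" using assms by linarith
  have "(cyclic_next zs ^^ Suc u) (zs ! i) = zs ! ((i + Suc u) mod ?d)"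
    using assms by (rule_tac cyclic_next_funpow_nth)
  also have "\<dots> = zs ! j \<longleftrightarrow> (i + Suc u) mod ?d = j"
    using assms d by (simp add: nth_eq_iff_index_eq)
  also have "\<dots> \<longleftrightarrow> (int i + int u + 1) mod int ?d = int j"
    by (metis (no_types, opaque_lifting) add.assoc of_nat_Suc of_nat_add of_nat_eq_iff of_nat_mod 
        add.commute)
  finally have "int (sent zs (zs ! i) (Suc u) (zs ! j)) = int (sent zs (zs ! i) u (zs ! j)) +
      (if (int i + int u + 1) mod int ?d = int j then 1 else 0)"
    by (simp add: sent_Suc del: funpow.simps)
  also have "\<dots> = (int u + 1 + (int i - int j) mod int ?d) div int ?d"
    using div_mod_Suc_shift[of "int ?d" "int j" "int u" "int i"] Suc assms(3) d by simp
  finally show ?case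
    by (simp add: add.commute)
qed

lemma sent_near_average:
  assumes "distinct zs" "r \<in> set zs" "w \<in> set zs"
  shows "\<bar>real (sent zs r u w) - real u / real (length zs)\<bar> \<le> 1"
proof -
  obtain i j where i: "i < length zs" "r = zs ! i" and j: "j < length zs" "w = zs ! j"
    using assms by (auto simp: in_set_conv_nth)
  define d where "d = int (length zs)"
  define e where "e = (int i - int j) mod d"
  define N where "N = int (sent zs r u w)"
  have d: "d > 0" using i unfolding d_def by linarith
  have e: "0 \<le> e" "e < d" using d unfolding e_def by auto
  have N: "N = (int u + e) div d"
    using sent_closed_form[OF assms(1) i(1) j(1), of u] i j by (simp add: N_def e_def d_def)
  define m where "m = (int u + e) mod d"
  have m: "0 \<le> m" "m < d" using d unfolding m_def by auto
  have "d * N = int u + e - m"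
    unfolding N m_def by (simp add: minus_mod_eq_mult_div)
  then have "\<bar>d * N - int u\<bar> \<le> d" using m e by linarith
  then have "\<bar>real_of_int d * N - real u\<bar> \<le> real_of_int d"
    by (metis (no_types, opaque_lifting) of_int_abs of_int_diff of_int_le_iff of_int_mult of_int_of_nat_eq)
  then have "\<bar>real_of_int N - real u / real_of_int d\<bar> \<le> 1"
    using d by (simp add: abs_le_iff field_simps)
  then show ?thesis by (simp add: N_def d_def)
qed

section \<open>Walks and exits from finite sets\<close>

definition departures :: "('v \<Rightarrow> 'v list) \<Rightarrow> 'v \<Rightarrow> ('v \<Rightarrow> 'v) \<Rightarrow> nat \<Rightarrow> 'v \<Rightarrow> nat" where
  "departures c z \<rho> t v = card {s. s < t \<and> fst (rotor_walk c z \<rho> s) = v}"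

lemma departures_0 [simp]: "departures c z \<rho> 0 v = 0"
  by (simp add: departures_def)

lemma departures_Suc:
  "departures c z \<rho> (Suc t) v =
     departures c z \<rho> t v + (if fst (rotor_walk c z \<rho> t) = v then 1 else 0)"
proof -
  have "{s. s < Suc t \<and> fst (rotor_walk c z \<rho> s) = v} =
        {s. s < t \<and> fst (rotor_walk c z \<rho> s) = v} \<union>
        (if fst (rotor_walk c z \<rho> t) = v then {t} else {})"
    by (auto simp: less_Suc_eq)
  then show ?thesis
    unfolding departures_def by (simp add: card_insert_if)
qed

lemma departures_mono: "s \<le> t \<Longrightarrow> departures c z \<rho> s v \<le> departures c z \<rho> t v"
  unfolding departures_def by (intro card_mono) auto

lemma rotor_walk_0 [simp]: "rotor_walk c z \<rho> 0 = (z, \<rho>)"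
  by (simp add: rotor_walk_def)

lemma rotor_walk_Suc: "rotor_walk c z \<rho> (Suc t) = rotor_step c (rotor_walk c z \<rho> t)"
  by (simp add: rotor_walk_def)

lemma snd_rotor_walk:
  "snd (rotor_walk c z \<rho> t) v = (cyclic_next (c v) ^^ departures c z \<rho> t v) (\<rho> v)"
proof (induction t arbitrary: v)
  case (Suc t)
  obtain p \<sigma> where p: "rotor_walk c z \<rho> t = (p, \<sigma>)" by force
  show ?case
    using Suc[of v] by (auto simp: rotor_walk_Suc rotor_step_def p departures_Suc Let_def)
qed simp

lemma fst_rotor_walk_Suc:
  assumes "fst (rotor_walk c z \<rho> t) = p"
  shows "fst (rotor_walk c z \<rho> (Suc t)) =
         (cyclic_next (c p) ^^ Suc (departures c z \<rho> t p)) (\<rho> p)"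
proof -
  obtain \<sigma> where p: "rotor_walk c z \<rho> t = (p, \<sigma>)" using assms by (metis prod.collapse)
  show ?thesis
    using snd_rotor_walk[of c z \<rho> t p]
    by (simp add: rotor_walk_Suc rotor_step_def p Let_def)
qed

lemma rotor_sequencesD:
  assumes "rotor_sequences adj c"
  shows "distinct (c z)" "w \<in> set (c z) \<longleftrightarrow> adj z w"
  using assms by (auto simp: rotor_sequences_def)

text \<open>
  A vertex that is left infinitely often has its rotor moved through each full turn infinitely
  often, so each of its neighbours is entered infinitely often.
\<close>
lemma infinitely_often_neighbour:
  assumes c: "rotor_sequences adj c" and \<rho>: "rotor_configuration adj \<rho>"
    and inf: "infinite {t. fst (rotor_walk c z \<rho> t) = v}" and adj: "adj v w"
  shows "infinite {t. fst (rotor_walk c z \<rho> t) = w}"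
proof -
  let ?pos = "\<lambda>t. fst (rotor_walk c z \<rho> t)" and ?dep = "\<lambda>t. departures c z \<rho> t v"
  have unbounded: "\<exists>t. ?dep t > k" for k
  proof -
    obtain B where B: "B \<subseteq> {t. ?pos t = v}" "finite B" "card B = Suc k"
      using infinite_arbitrarily_large[OF inf] by blast
    have "B \<subseteq> {s. s < Suc (Max B) \<and> ?pos s = v}"
      using B(1,2) by (auto simp: less_Suc_eq_le)
    then have "card B \<le> ?dep (Suc (Max B))"
      unfolding departures_def by (intro card_mono) auto
    then show ?thesis using B(3) by (intro exI[of _ "Suc (Max B)"]) simp
  qed
  have "\<exists>t>m. ?pos t = w" for m
  proof -
    have "distinct (c v)" "\<rho> v \<in> set (c v)" "w \<in> set (c v)"
      using c \<rho> adj by (auto simp: rotor_sequences_def rotor_configuration_def)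
    from cyclic_next_hits[OF this] obtain k
      where k: "k \<ge> ?dep (Suc m)" "(cyclic_next (c v) ^^ Suc k) (\<rho> v) = w" by blast
    \<comment> \<open>The step before this time is the departure number \<open>Suc k\<close> from \<open>v\<close>, which leads to \<open>w\<close>.\<close>
    define t where "t = (LEAST t. ?dep t > k)"
    have t: "?dep t > k" unfolding t_def using unbounded by (rule LeastI_ex)
    then obtain t' where t': "t = Suc t'" by (cases t) auto
    have "\<not> ?dep t' > k" using not_less_Least[of t' "\<lambda>t. ?dep t > k"] t' t_def by simp
    with t t' have "?pos t' = v" "?dep t' = k"
      by (auto simp: departures_Suc split: if_splits)
    then have "?pos t = w" using fst_rotor_walk_Suc[of c z \<rho> t' v] k(2) t' by simp
    moreover have "t > m"
      using t k(1) departures_mono[of t "Suc m" c z \<rho> v] by (metis leI le_SucI not_le order_trans)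
    ultimately show ?thesis by blast
  qed
  then show ?thesis
    by (metis (mono_tags) infinite_nat_iff_unbounded mem_Collect_eq)
qed

text \<open>
  In a finite set some vertex would be visited infinitely often, and this property spreads along
  edges until it reaches a vertex outside the set. Hence the exit times in the aggregation are
  attained.
\<close>
lemma rotor_walk_exits:
  assumes c: "rotor_sequences adj c" and \<rho>: "rotor_configuration adj \<rho>"
    and fin: "finite R" and out: "\<And>v. v \<in> R \<Longrightarrow> \<exists>w. adj\<^sup>*\<^sup>* v w \<and> w \<notin> R"
  shows "\<exists>t. fst (rotor_walk c z \<rho> t) \<notin> R"
proof (rule ccontr)
  assume "\<nexists>t. fst (rotor_walk c z \<rho> t) \<notin> R"
  then have inR: "\<And>t. fst (rotor_walk c z \<rho> t) \<in> R" by blast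
  then have "finite (range (\<lambda>t. fst (rotor_walk c z \<rho> t)))"
    using fin by (meson finite_subset image_subsetI)
  from pigeonhole_infinite[OF infinite_UNIV_nat this] obtain t0
    where "infinite {t. fst (rotor_walk c z \<rho> t) = fst (rotor_walk c z \<rho> t0)}" by auto
  moreover obtain w where w: "adj\<^sup>*\<^sup>* (fst (rotor_walk c z \<rho> t0)) w" "w \<notin> R"
    using out inR by blast
  ultimately have "infinite {t. fst (rotor_walk c z \<rho> t) = w}"
    using rtranclp_induct[OF w(1), of "\<lambda>w. infinite {t. fst (rotor_walk c z \<rho> t) = w}"]
      infinitely_often_neighbour[OF c \<rho>] by blast
  then obtain t where "fst (rotor_walk c z \<rho> t) = w"
    by (metis (mono_tags, lifting) finite.emptyI Collect_empty_eq)
  with inR w(2) show False by blast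
qed

section \<open>Flow through one-edge cuts\<close>

text \<open>
  The edge from \<open>z\<close> to \<open>w\<close> is the only connection between \<open>A\<close> and its complement, with
  \<open>w\<close> on the side of \<open>A\<close>. In a tree each edge gives such a cut.
\<close>
definition one_edge_cut :: "('v \<Rightarrow> 'v \<Rightarrow> bool) \<Rightarrow> 'v set \<Rightarrow> 'v \<Rightarrow> 'v \<Rightarrow> bool" where
  "one_edge_cut adj A z w \<longleftrightarrow> z \<notin> A \<and> w \<in> A \<and> adj z w \<and> adj w z \<and>
     (\<forall>p p'. adj p p' \<longrightarrow> (p \<notin> A \<and> p' \<in> A \<longrightarrow> p = z \<and> p' = w) \<and>
                          (p \<in> A \<and> p' \<notin> A \<longrightarrow> p = w \<and> p' = z))"

definition net_flow :: "('v \<Rightarrow> 'v list) \<Rightarrow> ('v \<Rightarrow> 'v) \<Rightarrow> ('v \<Rightarrow> nat) \<Rightarrow> 'v \<Rightarrow> 'v \<Rightarrow> int" where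
  "net_flow c \<rho> u z w = int (sent (c z) (\<rho> z) (u z) w) - int (sent (c w) (\<rho> w) (u w) z)"

text \<open>
  The particle can change sides only along the edge of the cut, so each step changes the net flow
  exactly as it changes the side on which the particle is.
\<close>
lemma net_flow_walk:
  assumes c: "rotor_sequences adj c" and \<rho>: "rotor_configuration adj \<rho>"
    and cut: "one_edge_cut adj A z w"
    and \<rho>': "\<And>v. \<rho>' v = (cyclic_next (c v) ^^ u v) (\<rho> v)"
  shows "net_flow c \<rho> (\<lambda>v. u v + departures c a \<rho>' t v) z w =
         net_flow c \<rho> u z w + of_bool (fst (rotor_walk c a \<rho>' t) \<in> A) - of_bool (a \<in> A)"
proof (induction t)
  case (Suc t)
  define p where "p = fst (rotor_walk c a \<rho>' t)"
  define p' where "p' = fst (rotor_walk c a \<rho>' (Suc t))"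
  let ?u = "\<lambda>v. u v + departures c a \<rho>' t v"
  have p': "p' = (cyclic_next (c p) ^^ Suc (?u p)) (\<rho> p)"
    unfolding p'_def fst_rotor_walk_Suc[OF p_def[symmetric]] \<rho>'
    by (metis (no_types, lifting) add.commute add_Suc_right comp_apply funpow_add)
  have "distinct (c p)" "\<rho> p \<in> set (c p)"
    using c \<rho> by (auto simp: rotor_sequences_def rotor_configuration_def)
  then have "p' \<in> set (c p)"
    unfolding p' by (rule cyclic_next_funpow_in_set)
  then have adj: "adj p p'" using rotor_sequencesD(2)[OF c] by blast
  have s: "sent (c v) (\<rho> v) (u v + departures c a \<rho>' (Suc t) v) v' =
           sent (c v) (\<rho> v) (?u v) v' + of_bool (p = v \<and> p' = v')" for v v'
    using p' by (auto simp: departures_Suc sent_Suc p_def[symmetric] simp del: funpow.simps)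
  have "of_bool (p = z \<and> p' = w) - of_bool (p = w \<and> p' = z) =
        (of_bool (p' \<in> A) - of_bool (p \<in> A) :: int)"
  proof (cases "p \<in> A"; cases "p' \<in> A")
    assume "p \<in> A" "p' \<notin> A"
    moreover from this have "p = w" "p' = z" "z \<noteq> w"
      using cut adj unfolding one_edge_cut_def by blast+
    ultimately show ?thesis by simp
  next
    assume "p \<notin> A" "p' \<in> A"
    moreover from this have "p = z" "p' = w" "z \<noteq> w"
      using cut adj unfolding one_edge_cut_def by blast+
    ultimately show ?thesis by simp
  next
    assume "p \<in> A" "p' \<in> A"
    then have "p \<noteq> z" "p' \<noteq> z" using cut unfolding one_edge_cut_def by auto
    then show ?thesis using \<open>p \<in> A\<close> \<open>p' \<in> A\<close> by simp
  next
    assume "p \<notin> A" "p' \<notin> A"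
    then have "p \<noteq> w" "p' \<noteq> w" using cut unfolding one_edge_cut_def by auto
    then show ?thesis using \<open>p \<notin> A\<close> \<open>p' \<notin> A\<close> by simp
  qed
  then show ?case
    using Suc unfolding net_flow_def s p_def[symmetric] p'_def[symmetric] by simp
qed (simp add: net_flow_def)

text \<open>
  The state of the aggregation does not record the odometer, so \<open>u\<close> is tied to it by
  its traces: it explains the current rotors, it vanishes off the cluster, and the particles in a
  set \<open>A\<close> that does not contain the source \<open>a\<close> have all flowed in through the edge of its cut.
\<close>
definition aggregation_odometer ::
  "('v \<Rightarrow> 'v \<Rightarrow> bool) \<Rightarrow> ('v \<Rightarrow> 'v list) \<Rightarrow> 'v \<Rightarrow> ('v \<Rightarrow> 'v) \<Rightarrow> 'v set \<Rightarrow> ('v \<Rightarrow> 'v) \<Rightarrow> ('v \<Rightarrow> nat) \<Rightarrow> bool"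
  where
  "aggregation_odometer adj c a \<rho> R \<rho>' u \<longleftrightarrow>
     (\<forall>v. \<rho>' v = (cyclic_next (c v) ^^ u v) (\<rho> v)) \<and> (\<forall>v. 0 < u v \<longrightarrow> v \<in> R) \<and>
     (\<forall>A z w. one_edge_cut adj A z w \<longrightarrow> a \<notin> A \<longrightarrow> int (card (R \<inter> A)) = net_flow c \<rho> u z w)"

text \<open>
  A new particle starts at \<open>a\<close>, hence outside the cut set, and until it stops it moves only from
  vertices of the old cluster. At the end it counts beyond the cut if and only if the newly occupied
  vertex lies there.
\<close>
lemma aggregation_invariant:
  assumes c: "rotor_sequences adj c" and \<rho>: "rotor_configuration adj \<rho>"
    and out: "\<And>R v. finite R \<Longrightarrow> \<exists>w. adj\<^sup>*\<^sup>* v w \<and> w \<notin> R"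
  shows "case aggregation c a \<rho> (Suc n) of (R, \<rho>') \<Rightarrow>
           finite R \<and> card R = Suc n \<and> a \<in> R \<and> (\<exists>u. aggregation_odometer adj c a \<rho> R \<rho>' u)"
proof (induction n)
  case 0
  have "aggregation_odometer adj c a \<rho> {a} \<rho> (\<lambda>_. 0)"
    by (auto simp: aggregation_odometer_def net_flow_def)
  then show ?case by auto
next
  case (Suc n)
  obtain R \<rho>' where agg: "aggregation c a \<rho> (Suc n) = (R, \<rho>')" by force
  with Suc obtain u where R: "finite R" "card R = Suc n" "a \<in> R"
    and odo: "aggregation_odometer adj c a \<rho> R \<rho>' u" by auto
  from odo have \<rho>': "\<And>v. \<rho>' v = (cyclic_next (c v) ^^ u v) (\<rho> v)"
    and supp: "\<And>v. 0 < u v \<Longrightarrow> v \<in> R"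
    and flow: "\<And>A z w. one_edge_cut adj A z w \<Longrightarrow> a \<notin> A \<Longrightarrow>
                 int (card (R \<inter> A)) = net_flow c \<rho> u z w"
    by (auto simp: aggregation_odometer_def)
  have conf': "rotor_configuration adj \<rho>'"
    unfolding rotor_configuration_def
  proof
    fix v
    have "distinct (c v)" "\<rho> v \<in> set (c v)"
      using c \<rho> by (auto simp: rotor_sequences_def rotor_configuration_def)
    then show "adj v (\<rho>' v)"
      using cyclic_next_funpow_in_set \<rho>' rotor_sequencesD(2)[OF c] by metis
  qed
  define T where "T = exit_time c a R \<rho>'"
  have ex: "\<exists>t. fst (rotor_walk c a \<rho>' t) \<notin> R"
    using rotor_walk_exits[OF c conf' R(1)] out[OF R(1)] by blast
  obtain w \<rho>'' where w: "rotor_walk c a \<rho>' T = (w, \<rho>'')" by force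
  have wR: "w \<notin> R"
    using LeastI_ex[OF ex] w unfolding T_def exit_time_def by simp
  have before: "fst (rotor_walk c a \<rho>' t) \<in> R" if "t < T" for t
    using that not_less_Least unfolding T_def exit_time_def by blast
  define u' where "u' = (\<lambda>v. u v + departures c a \<rho>' T v)"
  have "aggregation_odometer adj c a \<rho> (insert w R) \<rho>'' u'"
    unfolding aggregation_odometer_def
  proof (intro conjI allI impI)
    fix v
    have "\<rho>'' v = (cyclic_next (c v) ^^ departures c a \<rho>' T v) (\<rho>' v)"
      using snd_rotor_walk[of c a \<rho>' T v] w by simp
    then show "\<rho>'' v = (cyclic_next (c v) ^^ u' v) (\<rho> v)"
      unfolding u'_def \<rho>' by (metis add.commute comp_apply funpow_add)
  next
    fix v assume "0 < u' v"
    then consider "0 < u v" | "departures c a \<rho>' T v > 0" unfolding u'_def by linarith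
    then show "v \<in> insert w R"
    proof cases
      case 2
      then obtain s where "s < T" "fst (rotor_walk c a \<rho>' s) = v"
        unfolding departures_def by (auto simp: card_gt_0_iff)
      then show ?thesis using before by blast
    qed (use supp in auto)
  next
    fix A z v assume A: "one_edge_cut adj A z v" "a \<notin> A"
    have "net_flow c \<rho> u' z v = int (card (R \<inter> A)) + of_bool (w \<in> A)"
      unfolding u'_def using net_flow_walk[OF c \<rho> A(1) \<rho>'] flow[OF A] A(2) w by simp
    then show "int (card (insert w R \<inter> A)) = net_flow c \<rho> u' z v"
      using wR R(1) by (simp add: Int_insert_left)
  qed
  then show ?case
    using R wR agg w by (auto simp: T_def[symmetric])
qed

text \<open>
  Both directions of the edge are used an average number of times up to an error of one each; the
  two errors add up to two.
\<close>
lemma flow_near_odometer_difference: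
  assumes c: "rotor_sequences adj c" and \<rho>: "rotor_configuration adj \<rho>"
    and odo: "aggregation_odometer adj c a \<rho> R \<rho>' u"
    and cut: "one_edge_cut adj A z w" "a \<notin> A"
  shows "\<bar>real (u z) / real (length (c z)) - real (u w) / real (length (c w)) -
           real (card (R \<inter> A))\<bar> \<le> 2"
proof -
  have near: "\<bar>real (sent (c v) (\<rho> v) (u v) v') - real (u v) / real (length (c v))\<bar> \<le> 1"
    if "adj v v'" for v v'
    using that c \<rho> 
    by (intro sent_near_average) (auto simp: rotor_sequences_def rotor_configuration_def)
  have "int (card (R \<inter> A)) = net_flow c \<rho> u z w"
    using odo cut unfolding aggregation_odometer_def by blast
  then have "real (card (R \<inter> A)) =
      real (sent (c z) (\<rho> z) (u z) w) - real (sent (c w) (\<rho> w) (u w) z)"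
    unfolding net_flow_def by linarith
  moreover have "adj z w" "adj w z" using cut by (auto simp: one_edge_cut_def)
  ultimately show ?thesis using near[of z w] near[of w z] by linarith
qed

text \<open>
  Particles beyond a cut must have passed through it, so its inner endpoint has been left by some
  particle. On the comb this makes teeth and half-spines intervals.
\<close>
lemma cut_source_in_cluster:
  assumes odo: "aggregation_odometer adj c a \<rho> R \<rho>' u"
    and cut: "one_edge_cut adj A z w" "a \<notin> A"
    and R: "finite R" "v \<in> R" "v \<in> A"
  shows "z \<in> R"
proof -
  have "0 < card (R \<inter> A)" using R by (auto simp: card_gt_0_iff)
  moreover have "int (card (R \<inter> A)) = net_flow c \<rho> u z w"
    using odo cut unfolding aggregation_odometer_def by blast
  ultimately have "u z \<noteq> 0" unfolding net_flow_def by (intro notI) simp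
  then show ?thesis using odo unfolding aggregation_odometer_def by blast
qed

section \<open>Teeth\<close>

text \<open>
  Here \<open>a j\<close> is the odometer at height \<open>j\<close> on a tooth and \<open>h - j\<close> is the number of
  particles above it. Summing \<open>0 + 1 + \<dots> + (n - 1)\<close> from the tip yields the product
  \<open>(n - 1) * n\<close>, and each of the \<open>n\<close> steps contributes an error of at most \<open>4\<close>.
\<close>
lemma tooth_odometer:
  fixes a :: "nat \<Rightarrow> real"
  assumes zero: "\<And>j. h < j \<Longrightarrow> a j = 0"
    and step: "\<And>j. 1 \<le> j \<Longrightarrow> \<bar>a j / 2 - a (Suc j) / 2 - real (h - j)\<bar> \<le> 2"
  shows "n \<le> h \<Longrightarrow> \<bar>a (Suc h - n) - (real n - 1) * real n\<bar> \<le> 4 * real n"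
proof (induction n)
  case 0
  then show ?case using zero[of "Suc h"] by simp
next
  case (Suc n)
  have j: "1 \<le> h - n" "Suc (h - n) = Suc h - n" "h - (h - n) = n" using Suc.prems by auto
  from step[OF j(1)] have "\<bar>a (h - n) / 2 - a (Suc h - n) / 2 - real n\<bar> \<le> 2"
    unfolding j(2,3) .
  moreover have "\<bar>a (Suc h - n) - (real n - 1) * real n\<bar> \<le> 4 * real n"
    using Suc by simp
  ultimately show ?case by (simp add: algebra_simps abs_le_iff)
qed

text \<open>
  The base has degree \<open>4\<close> instead of \<open>2\<close>, so one more step gives
  \<open>a 0 / 2 = h * (h + 1)\<close> with error at most \<open>4 * (h + 1)\<close>; such a relative error of order
  \<open>1 / h\<close> changes the square root only by a constant.
\<close>
lemma tooth_height_root: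
  fixes a :: "nat \<Rightarrow> real"
  assumes zero: "\<And>j. h < j \<Longrightarrow> a j = 0"
    and step: "\<And>j. 1 \<le> j \<Longrightarrow> \<bar>a j / 2 - a (Suc j) / 2 - real (h - j)\<bar> \<le> 2"
    and base: "\<bar>a 0 / 4 - a 1 / 2 - real h\<bar> \<le> 2" and nonneg: "0 \<le> a 0"
  shows "\<bar>sqrt (a 0 / 2) - real h\<bar> \<le> 4"
proof -
  have "\<bar>a (Suc h - h) - (real h - 1) * real h\<bar> \<le> 4 * real h"
    using zero step by (rule tooth_odometer) auto
  with base have sq: "\<bar>a 0 / 2 - real h * (real h + 1)\<bar> \<le> 4 * (real h + 1)"
    by (simp add: algebra_simps abs_le_iff)
  have "a 0 / 2 \<le> (real h + 4)\<^sup>2"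
    using sq by (simp add: power2_eq_square algebra_simps abs_le_iff)
  then have "sqrt (a 0 / 2) \<le> real h + 4"
    by (rule real_le_lsqrt[rotated]) simp
  moreover have "real h - 4 \<le> sqrt (a 0 / 2)"
  proof (cases "h \<ge> 4")
    case True
    have "(real h - 4)\<^sup>2 \<le> (real h - 4) * (real h + 1)"
      unfolding power2_eq_square using True by (intro mult_left_mono) auto
    also have "\<dots> \<le> a 0 / 2"
      using sq by (simp add: algebra_simps abs_le_iff)
    finally show ?thesis by (rule real_le_rsqrt)
  next
    case False
    then show ?thesis using real_sqrt_ge_zero[of "a 0 / 2"] nonneg by linarith
  qed
  ultimately show ?thesis by linarith
qed

section \<open>The recurrence along the spine\<close>

text \<open>
  A supersolution. The polynomials are \<open>s\<^sup>2 / 3\<close> and \<open>2 s\<^sup>3 / 9\<close> with the corrections needed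
  to absorb the errors \<open>4\<close> and \<open>9\<close> of each step. The constant in \<open>P\<close> has to be negative:
  changing \<open>P\<close> by a constant \<open>D\<close> changes the increment of \<open>P\<^sup>2\<close> by about \<open>4 D s / 3\<close>,
  but twice the resulting change of \<open>Q\<close> is about \<open>4 D s\<close>, and for \<open>D = - 9\<close> this
  difference outweighs the accumulated errors. The shift by \<open>9\<close> lifts \<open>P\<close> and
  \<open>Q\<close> above the values at the tip.
\<close>
lemma spine_recurrence_upper:
  fixes q T :: "nat \<Rightarrow> real"
  assumes "q 0 \<le> 2" "T 0 \<le> 13"
    and q: "\<And>r. r < b \<Longrightarrow> (q (Suc r))\<^sup>2 \<le> (q r)\<^sup>2 + 2 * T r + 4"
    and T: "\<And>r. r < b \<Longrightarrow> T (Suc r) \<le> T r + 2 * q (Suc r) + 9"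
    and nonneg: "\<And>r. 0 \<le> q r"
  defines "P \<equiv> \<lambda>s::real. s\<^sup>2 / 3 - 9"
    and "Q \<equiv> \<lambda>s::real. 2 / 9 * s ^ 3 + s\<^sup>2 / 3 - 80 / 9 * s - 18"
  shows "r \<le> b \<Longrightarrow> q r \<le> P (real r + 9) \<and> T r \<le> Q (real r + 9)"
proof (induction r)
  case 0
  show ?case using assms(1,2) by (simp add: P_def Q_def power_divide)
next
  case (Suc r)
  define s where "s = real r + 9"
  have s: "9 \<le> s" by (simp add: s_def)
  have IH: "q r \<le> P s" "T r \<le> Q s" using Suc by (simp_all add: s_def)
  have "(q (Suc r))\<^sup>2 \<le> (q r)\<^sup>2 + 2 * T r + 4" using Suc.prems by (intro q) simp
  also have "(q r)\<^sup>2 \<le> (P s)\<^sup>2" using IH(1) nonneg by (intro power_mono)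
  also have "(P s)\<^sup>2 + 2 * T r + 4 \<le> (P s)\<^sup>2 + 2 * Q s + 4" using IH(2) by simp
  also have "\<dots> = (P (s + 1))\<^sup>2 - (56 / 9 * (s + 1) + 179 / 9)"
    by (simp add: P_def Q_def power2_eq_square power3_eq_cube field_simps)
  also have "\<dots> \<le> (P (s + 1))\<^sup>2"
  proof -
    have "0 \<le> 56 / 9 * (s + 1) + 179 / 9" using s by simp
    then show ?thesis by linarith
  qed
  finally have "(q (Suc r))\<^sup>2 \<le> (P (s + 1))\<^sup>2" by simp
  moreover have "9\<^sup>2 \<le> (s + 1)\<^sup>2" using s by (intro power_mono) auto
  then have "0 \<le> P (s + 1)" by (simp add: P_def)
  ultimately have q': "q (Suc r) \<le> P (s + 1)" by (rule power2_le_imp_le)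
  have "T (Suc r) \<le> T r + 2 * q (Suc r) + 9" using Suc.prems by (intro T) simp
  also have "\<dots> \<le> Q s + 2 * P (s + 1) + 9" using q' IH(2) by simp
  also have "\<dots> = Q (s + 1)"
    by (simp add: P_def Q_def power2_eq_square power3_eq_cube field_simps)
  finally show ?case using q' by (simp add: s_def add.commute add.left_commute)
qed

text \<open>
  A subsolution with a positive constant term cannot be started at the tip, where the heights may vanish.
  Since each column contains a particle, \<open>T\<close> grows at least linearly and therefore \<open>q\<close> as
  well, so that after a fixed number of steps both are as large as required.
\<close>
lemma spine_recurrence_start:
  fixes q T :: "nat \<Rightarrow> real"
  assumes "1 \<le> T 0"
    and q: "\<And>r. r < b \<Longrightarrow> (q r)\<^sup>2 + 2 * T r - 4 \<le> (q (Suc r))\<^sup>2"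
    and T1: "\<And>r. r < b \<Longrightarrow> T r + 1 \<le> T (Suc r)"
  shows "r \<le> b \<Longrightarrow> real r * (real r - 3) \<le> (q r)\<^sup>2 \<and> real r + 1 \<le> T r"
proof (induction r)
  case (Suc r)
  have "(q r)\<^sup>2 + 2 * T r - 4 \<le> (q (Suc r))\<^sup>2" "T r + 1 \<le> T (Suc r)"
    using Suc.prems by (auto intro!: q T1)
  with Suc show ?case by (simp add: algebra_simps)
qed (use assms in simp)

text \<open>
  The mirror image of the supersolution, with a positive constant in \<open>P\<close>, started \<open>26\<close> steps
  from the tip: there \<open>q\<^sup>2 \<ge> 26 * 23\<close> and \<open>T \<ge> 27\<close>.
\<close>
lemma spine_recurrence_lower:
  fixes q T :: "nat \<Rightarrow> real"
  assumes "1 \<le> T 0"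
    and q: "\<And>r. r < b \<Longrightarrow> (q r)\<^sup>2 + 2 * T r - 4 \<le> (q (Suc r))\<^sup>2"
    and T: "\<And>r. r < b \<Longrightarrow> T r + 2 * q (Suc r) - 9 \<le> T (Suc r)"
    and T1: "\<And>r. r < b \<Longrightarrow> T r + 1 \<le> T (Suc r)"
    and nonneg: "\<And>r. 0 \<le> q r"
  defines "P \<equiv> \<lambda>s::real. s\<^sup>2 / 3 + 9"
    and "Q \<equiv> \<lambda>s::real. 2 / 9 * s ^ 3 + s\<^sup>2 / 3 + 9 * s + 27"
  shows "r + 26 \<le> b \<Longrightarrow> P (real r) \<le> q (r + 26) \<and> Q (real r) \<le> T (r + 26)"
proof (induction r)
  case 0
  then have "real 26 * (real 26 - 3) \<le> (q 26)\<^sup>2 \<and> real 26 + 1 \<le> T 26"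
    by (intro spine_recurrence_start[of T b q] assms) auto
  then have "9\<^sup>2 \<le> (q 26)\<^sup>2" "27 \<le> T 26" by simp_all
  with nonneg show ?case by (auto simp: P_def Q_def intro: power2_le_imp_le)
next
  case (Suc r)
  define s where "s = real r"
  have s: "0 \<le> s" by (simp add: s_def)
  have IH: "P s \<le> q (r + 26)" "Q s \<le> T (r + 26)" using Suc by (simp_all add: s_def)
  have P0: "0 \<le> P s" by (simp add: P_def)
  have "(P (s + 1))\<^sup>2 \<le> (P (s + 1))\<^sup>2 + (50 / 9 * (s + 1) + 115 / 3)" using s by simp
  also have "\<dots> = (P s)\<^sup>2 + 2 * Q s - 4"
    by (simp add: P_def Q_def power2_eq_square power3_eq_cube field_simps)
  also have "\<dots> \<le> (q (r + 26))\<^sup>2 + 2 * T (r + 26) - 4"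
    using power_mono[OF IH(1) P0, of 2] IH(2) by simp
  also have "\<dots> \<le> (q (Suc r + 26))\<^sup>2" using q[of "r + 26"] Suc.prems by simp
  finally have q': "P (s + 1) \<le> q (Suc r + 26)" using nonneg by (rule power2_le_imp_le)
  have "Q (s + 1) = Q s + 2 * P (s + 1) - 9 - 1 / 9"
    by (simp add: P_def Q_def power2_eq_square power3_eq_cube field_simps)
  also have "\<dots> \<le> T (r + 26) + 2 * q (Suc r + 26) - 9" using q' IH(2) by simp
  also have "\<dots> \<le> T (Suc r + 26)" using T[of "r + 26"] Suc.prems by simp
  finally show ?case using q' by (simp add: s_def add.commute)
qed

section \<open>Shape of a comb cluster with balanced flows\<close>

lemma finite_initial_segment_nat:
  assumes "finite (S :: nat set)" "\<And>j. Suc j \<in> S \<Longrightarrow> j \<in> S"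
  shows "\<exists>h. S = {..<h}"
proof -
  obtain h0 where "h0 \<notin> S" using assms(1) ex_new_if_finite infinite_UNIV_nat by blast
  define h where "h = (LEAST h. h \<notin> S)"
  have h: "h \<notin> S" unfolding h_def by (rule LeastI) fact
  have down: "i \<le> j \<Longrightarrow> j \<in> S \<Longrightarrow> i \<in> S" for i j
    by (induction rule: inc_induct) (auto intro: assms(2))
  have "j \<in> S \<longleftrightarrow> j < h" for j
    using h down[of h j] not_less_Least[of j "\<lambda>h. h \<notin> S"] unfolding h_def[symmetric]
    by (meson leI)
  then show ?thesis by blast
qed

text \<open>
  What the geometry needs from a cluster \<open>R\<close> and its odometer \<open>u\<close>. The signs \<open>t\<close> and
  \<open>s\<close> select the upper or lower tooth and the right or left half of the spine, so that
  each argument is given once.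
\<close>
locale comb_flow =
  fixes R :: "(int \<times> int) set" and u :: "int \<times> int \<Rightarrow> nat"
  assumes finite_R: "finite R" and origin_in_R: "(0, 0) \<in> R"
    and support: "0 < u z \<Longrightarrow> z \<in> R"
    and tooth_connected: "t \<in> {1, - 1} \<Longrightarrow> (x, t * int (Suc j)) \<in> R \<Longrightarrow> (x, t * int j) \<in> R"
    and spine_connected: "s \<in> {1, - 1} \<Longrightarrow> (s * int (Suc i), 0) \<in> R \<Longrightarrow> (s * int i, 0) \<in> R"
    and tooth_base_flow: "t \<in> {1, - 1} \<Longrightarrow> 
      \<bar>real (u (x, 0)) / 4 - real (u (x, t)) / 2 - 
         real (card (R \<inter> {(x', y). x' = x \<and> 0 < t * y}))\<bar> \<le> 2"
    and tooth_flow: "t \<in> {1, - 1} \<Longrightarrow> 1 \<le> j \<Longrightarrow>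
      \<bar>real (u (x, t * int j)) / 2 - real (u (x, t * int (Suc j))) / 2 - 
         real (card (R \<inter> {(x', y). x' = x \<and> int j < t * y}))\<bar> \<le> 2"
    and spine_flow: "s \<in> {1, - 1} \<Longrightarrow>
      \<bar>real (u (s * int i, 0)) / 4 - real (u (s * int (Suc i), 0)) / 4 - 
         real (card (R \<inter> {(x, y). int i < s * x}))\<bar> \<le> 2"
begin

lemma tooth_shape:
  assumes t: "t \<in> {1, - 1 :: int}"
  obtains h where "\<And>j. (x, t * int (Suc j)) \<in> R \<longleftrightarrow> j < h"
    and "\<And>j. card (R \<inter> {(x', y). x' = x \<and> int j < t * y}) = h - j"
proof -
  define S where "S = {j. (x, t * int (Suc j)) \<in> R}"
  define f where "f = (\<lambda>j. (x, t * int (Suc j)))"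
  have inj: "inj f" using t by (auto simp: f_def inj_on_def)
  have "finite S" 
    using finite_vimageI[OF finite_R inj] by (simp add: S_def f_def vimage_def)
  moreover have "Suc j \<in> S \<Longrightarrow> j \<in> S" for j
    using tooth_connected[OF t, of x "Suc j"] unfolding S_def by simp
  ultimately obtain h where "S = {..<h}"
    using finite_initial_segment_nat[of S] by blast
  then have h: "f j \<in> R \<longleftrightarrow> j < h" for j
    unfolding S_def f_def by (metis lessThan_iff mem_Collect_eq)
  have "card (R \<inter> {(x', y). x' = x \<and> int j < t * y}) = h - j" for j
  proof -
    have "R \<inter> {(x', y). x' = x \<and> int j < t * y} = f ` {j..<h}"
    proof (intro equalityI subsetI)
      fix p assume p: "p \<in> R \<inter> {(x', y). x' = x \<and> int j < t * y}"
      define i where "i = nat (t * snd p) - 1"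
      have i: "p = f i" "j \<le> i" using p t by (auto simp: f_def i_def)
      moreover have "i < h" using p i(1) h by auto
      ultimately show "p \<in> f ` {j..<h}" by auto
    next
      fix p assume "p \<in> f ` {j..<h}"
      then obtain i where i: "p = f i" "j \<le> i" "i < h" by auto
      then have "p \<in> R" using h by blast
      moreover have "int j < t * (t * int (Suc i))" using i t by auto
      ultimately show "p \<in> R \<inter> {(x', y). x' = x \<and> int j < t * y}"
        using i(1) by (simp add: f_def)
    qed
    moreover have "inj_on f {j..<h}" using inj by (rule inj_on_subset) simp
    ultimately show ?thesis by (simp add: card_image)
  qed
  with h show ?thesis unfolding f_def by (rule that)
qed

lemma spine_in_R: "(x, y) \<in> R \<Longrightarrow> (x, 0) \<in> R"
proof -
  have down: "(x, t * int j) \<in> R \<Longrightarrow> (x, 0) \<in> R" if "t \<in> {1, - 1}" for t j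
    by (induction j) (use tooth_connected[OF that] in auto)
  assume "(x, y) \<in> R"
  then have xy: "(x, 1 * int (nat y)) \<in> R \<or> (x, - 1 * int (nat (- y))) \<in> R"
    by (cases "y \<ge> 0") auto
  show ?thesis
    using xy by (elim disjE down[rotated]) auto
qed

text \<open>
  The height that both teeth at \<open>x\<close> would have if all rotors were perfectly balanced.
\<close>
definition ideal_height :: "int \<Rightarrow> real" where
  "ideal_height x = sqrt (real (u (x, 0)) / 2)"

lemma tooth_height:
  assumes t: "t \<in> {1, - 1 :: int}"
  obtains h where "\<And>j. (x, t * int (Suc j)) \<in> R \<longleftrightarrow> j < h"
    and "card (R \<inter> {(x', y). x' = x \<and> 0 < t * y}) = h" and "\<bar>ideal_height x - real h\<bar> \<le> 4"
proof -
  obtain h where h: "\<And>j. (x, t * int (Suc j)) \<in> R \<longleftrightarrow> j < h"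
    "\<And>j. card (R \<inter> {(x', y). x' = x \<and> int j < t * y}) = h - j"
    using tooth_shape[OF t] by blast
  have "\<bar>sqrt (real (u (x, t * int 0)) / 2) - real h\<bar> \<le> 4"
  proof (rule tooth_height_root)
    fix j assume "h < j"
    then have "(x, t * int j) \<notin> R" using h(1)[of "j - 1"] by simp
    then show "real (u (x, t * int j)) = 0" using support by fastforce
  next
    fix j :: nat assume "1 \<le> j"
    from tooth_flow[OF t this, of x]
    show "\<bar>real (u (x, t * int j)) / 2 - real (u (x, t * int (Suc j))) / 2 - real (h - j)\<bar> \<le> 2"
      unfolding h(2) .
  next
    show "\<bar>real (u (x, t * int 0)) / 4 - real (u (x, t * int 1)) / 2 - real h\<bar> \<le> 2"
      using tooth_base_flow[OF t, of x] h(2)[of 0] by simp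
  qed simp
  then show ?thesis using that[of h] h(1) h(2)[of 0] by (simp add: ideal_height_def)
qed

lemma column_size:
  assumes "(x, 0) \<in> R"
  shows "\<bar>real (card (R \<inter> {(x', y). x' = x})) - 2 * ideal_height x\<bar> \<le> 9"
    and "1 \<le> card (R \<inter> {(x', y). x' = x})"
proof -
  define U where "U = R \<inter> {(x', y). x' = x \<and> 0 < 1 * y}"
  define D where "D = R \<inter> {(x', y). x' = x \<and> 0 < -1 * y}"
  have e: "R \<inter> {(x', y). x' = x} = insert (x, 0) (U \<union> D)"
    using assms by (auto simp: U_def D_def)
  have fin: "finite U" "finite D" using finite_R by (auto simp: U_def D_def)
  have "card (insert (x, 0) (U \<union> D)) = Suc (card (U \<union> D))"
    using fin by (intro card_insert_disjoint) (auto simp: U_def D_def)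
  also have "card (U \<union> D) = card U + card D"
    using fin by (intro card_Un_disjoint) (auto simp: U_def D_def)
  finally have c: "card (R \<inter> {(x', y). x' = x}) = Suc (card U + card D)" using e by simp
  have "\<bar>ideal_height x - real (card U)\<bar> \<le> 4" "\<bar>ideal_height x - real (card D)\<bar> \<le> 4"
    using tooth_height[of 1 x] tooth_height[of "-1" x] unfolding U_def D_def by auto
  with c show "\<bar>real (card (R \<inter> {(x', y). x' = x})) - 2 * ideal_height x\<bar> \<le> 9"
    by (simp add: abs_le_iff)
  show "1 \<le> card (R \<inter> {(x', y). x' = x})" using c by simp
qed

text \<open>
  Reading the spine from its last occupied position \<open>b\<close> towards the origin turns the flow
  relations into the recurrence: the edge into column \<open>b - r\<close> carries the \<open>T r\<close> particles beyond it,
  and a column contains twice its ideal height up to \<open>9\<close>, namely \<open>4\<close> for each tooth and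
  \<open>1\<close> for the vertex on the spine.
\<close>
lemma half_spine:
  assumes s: "s \<in> {1, - 1 :: int}"
  obtains b where "\<And>i. (s * int i, 0) \<in> R \<longleftrightarrow> i \<le> b"
    and "real (card (R \<inter> {(x, y). 0 \<le> s * x})) \<le> 2 / 9 * (real b + 10) ^ 3"
    and "ideal_height 0 \<le> (real b + 9)\<^sup>2 / 3 - 9"
    and "\<And>i. i + 26 \<le> b \<Longrightarrow> (real b - real i - 26)\<^sup>2 / 3 + 9 \<le> ideal_height (s * int i)"
proof -
  define S where "S = {i. (s * int i, 0) \<in> R}"
  have "inj (\<lambda>i. (s * int i, 0::int))" using s by (auto simp: inj_on_def)
  from finite_vimageI[OF finite_R this] have "finite S" by (simp add: S_def vimage_def)
  then obtain b' where b': "S = {..<b'}"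
    using finite_initial_segment_nat[of S] spine_connected[OF s] S_def by blast
  moreover have "0 \<in> S" using origin_in_R by (simp add: S_def)
  ultimately obtain b where "b' = Suc b" by (cases b') auto
  with b' have "S = {..b}" by (simp add: lessThan_Suc_atMost)
  then have b: "(s * int i, 0) \<in> R \<longleftrightarrow> i \<le> b" for i by (auto simp: S_def)
  define G where "G = (\<lambda>i::int. R \<inter> {(x, y). i \<le> s * x})"
  define q where "q = (\<lambda>r. ideal_height (s * int (b - r)))"
  define T where "T = (\<lambda>r. real (card (G (int (b - r)))))"
  define col where "col = (\<lambda>r. real (card (R \<inter> {(x, y). x = s * int (b - r)})))"
  have G_Suc: "G (int (Suc i)) = R \<inter> {(x, y). int i < s * x}" for i
    by (auto simp: G_def)
  have col: "\<bar>col r - 2 * q r\<bar> \<le> 9" "1 \<le> col r" if "r \<le> b" for r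
    using column_size[of "s * int (b - r)"] b[of "b - r"] by (auto simp: col_def q_def)
  have split: "card (G (int i)) = card (G (int (Suc i))) + card (R \<inter> {(x, y). x = s * int i})" for i
  proof -
    have "G (int i) = G (int (Suc i)) \<union> (R \<inter> {(x, y). x = s * int i})"
      using s by (auto simp: G_def)
    moreover have "G (int (Suc i)) \<inter> (R \<inter> {(x, y). x = s * int i}) = {}"
      using s by (auto simp: G_def)
    ultimately show ?thesis
      using finite_R by (simp add: card_Un_disjoint G_def)
  qed
  have empty: "G (int (Suc b)) = {}"
  proof -
    have False if "(x, y) \<in> R" "int (Suc b) \<le> s * x" for x y
    proof -
      have "x = s * int (nat (s * x))" using that s by auto
      then have "nat (s * x) \<le> b" using spine_in_R[OF that(1)] b by metis
      with that(2) show False by linarith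
    qed
    then show ?thesis by (auto simp: G_def)
  qed
  have T0: "T 0 = col 0" using split[of b] empty by (simp add: T_def col_def)
  have T_Suc: "T (Suc r) = T r + col (Suc r)" if "r < b" for r
    using split[of "b - Suc r"] that by (simp add: T_def col_def Suc_diff_Suc del: of_nat_Suc)
  have q_sq: "(q r)\<^sup>2 = real (u (s * int (b - r), 0)) / 2" for r
    by (simp add: q_def ideal_height_def)
  have q0: "q 0 \<le> 2"
  proof -
    have "(s * int (Suc b), 0) \<notin> R" using b[of "Suc b"] by (simp del: of_nat_Suc)
    then have "u (s * int (Suc b), 0) = 0" using support by (metis gr0I)
    then have "(q 0)\<^sup>2 \<le> 2\<^sup>2"
      using spine_flow[OF s, of b] empty q_sq[of 0] unfolding G_Suc by simp
    then show ?thesis by (rule power2_le_imp_le) simp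
  qed
  have q_Suc: "\<bar>(q (Suc r))\<^sup>2 - (q r)\<^sup>2 - 2 * T r\<bar> \<le> 4" if "r < b" for r
  proof -
    have "Suc (b - Suc r) = b - r" using that by simp
    with spine_flow[OF s, of "b - Suc r"] show ?thesis
      unfolding q_sq T_def G_Suc[symmetric] by (simp add: abs_le_iff)
  qed
  have q_pos: "0 \<le> q r" for r by (simp add: q_def ideal_height_def)
  have upper: "q b \<le> (real b + 9)\<^sup>2 / 3 - 9 \<and>
      T b \<le> 2 / 9 * (real b + 9) ^ 3 + (real b + 9)\<^sup>2 / 3 - 80 / 9 * (real b + 9) - 18"
  proof (rule spine_recurrence_upper[of q T b b])
    show "T 0 \<le> 13" using T0 col(1)[of 0] q0 by simp
    show "(q (Suc r))\<^sup>2 \<le> (q r)\<^sup>2 + 2 * T r + 4" if "r < b" for r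
      using q_Suc[OF that] by linarith
    show "T (Suc r) \<le> T r + 2 * q (Suc r) + 9" if "r < b" for r
      using T_Suc[OF that] col(1)[of "Suc r"] that by simp
  qed (use q0 q_pos in auto)
  have lower: "(real r)\<^sup>2 / 3 + 9 \<le> q (r + 26)" if "r + 26 \<le> b" for r
  proof -
    have "1 \<le> T 0" using T0 col(2)[of 0] by simp
    moreover have "(q r)\<^sup>2 + 2 * T r - 4 \<le> (q (Suc r))\<^sup>2" if "r < b" for r
      using q_Suc[OF that] by linarith
    moreover have "T r + 2 * q (Suc r) - 9 \<le> T (Suc r)" if "r < b" for r
      using T_Suc[OF that] col(1)[of "Suc r"] that by simp
    moreover have "T r + 1 \<le> T (Suc r)" if "r < b" for r
      using T_Suc[OF that] col(2)[of "Suc r"] that by simp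
    ultimately show ?thesis
      using spine_recurrence_lower[of T b q r] q_pos that by blast
  qed
  show ?thesis
  proof (rule that[of b])
    define v where "v = real b + 9"
    have "0 \<le> v" by (simp add: v_def)
    then have "2 / 9 * v ^ 3 + v\<^sup>2 / 3 - 80 / 9 * v - 18 \<le> 2 / 9 * (v + 1) ^ 3"
      by (simp add: power2_eq_square power3_eq_cube field_simps)
    then have "T b \<le> 2 / 9 * (v + 1) ^ 3"
      using upper unfolding v_def by linarith
    then show "real (card (R \<inter> {(x, y). 0 \<le> s * x})) \<le> 2 / 9 * (real b + 10) ^ 3"
      by (simp add: T_def G_def v_def add.assoc)
    show "ideal_height 0 \<le> (real b + 9)\<^sup>2 / 3 - 9" using upper by (simp add: q_def)
    fix i assume "i + 26 \<le> b"
    then show "(real b - real i - 26)\<^sup>2 / 3 + 9 \<le> ideal_height (s * int i)"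
      using lower[of "b - i - 26"] by (simp add: q_def of_nat_diff diff_diff_eq)
  qed (rule b)
qed

text \<open>
  The lower bound from one half and the upper bound from the other apply to the same ideal height at the origin.
\<close>
lemma half_spines_comparable:
  assumes "\<And>i. i + 26 \<le> b \<Longrightarrow> (real b - real i - 26)\<^sup>2 / 3 + 9 \<le> ideal_height (s * int i)"
    and "ideal_height 0 \<le> (real b' + 9)\<^sup>2 / 3 - 9"
  shows "real b \<le> real b' + 35"
proof (cases "26 \<le> b")
  case True
  then have "(real b - 26)\<^sup>2 / 3 + 9 \<le> ideal_height 0" using assms(1)[of 0] by simp
  with assms(2) have "(real b - 26)\<^sup>2 \<le> (real b' + 9)\<^sup>2" by simp
  then have "real b - 26 \<le> real b' + 9" by (rule power2_le_imp_le) simp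
  then show ?thesis by simp
qed simp

text \<open>
  The particles fill the two half-combs, of lengths \<open>b\<close> and at most \<open>b + 35\<close>, so a cluster
  of given size forces either half to be long.
\<close>
lemma cluster_size_le:
  assumes "s \<in> {1, - 1 :: int}"
  obtains b where "\<And>i. (s * int i, 0) \<in> R \<longleftrightarrow> i \<le> b"
    and "9 / 4 * real (card R) \<le> (real b + 45) ^ 3"
    and "\<And>i. i + 26 \<le> b \<Longrightarrow> (real b - real i - 26)\<^sup>2 / 3 + 9 \<le> ideal_height (s * int i)"
proof -
  obtain b where b: "\<And>i. (s * int i, 0) \<in> R \<longleftrightarrow> i \<le> b"
    "real (card (R \<inter> {(x, y). 0 \<le> s * x})) \<le> 2 / 9 * (real b + 10) ^ 3"
    "ideal_height 0 \<le> (real b + 9)\<^sup>2 / 3 - 9"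
    "\<And>i. i + 26 \<le> b \<Longrightarrow> (real b - real i - 26)\<^sup>2 / 3 + 9 \<le> ideal_height (s * int i)"
    using half_spine[OF assms] by blast
  have "- s \<in> {1, - 1}" using assms by auto
  then obtain b' where b':
    "real (card (R \<inter> {(x, y). 0 \<le> - s * x})) \<le> 2 / 9 * (real b' + 10) ^ 3"
    "\<And>i. i + 26 \<le> b' \<Longrightarrow> (real b' - real i - 26)\<^sup>2 / 3 + 9 \<le> ideal_height (- s * int i)"
    using half_spine[of "- s"] by blast
  have "real b' \<le> real b + 35" by (rule half_spines_comparable[OF b'(2) b(3)])
  then have "(real b' + 10) ^ 3 \<le> (real b + 45) ^ 3" by (intro power_mono) auto
  moreover have "(real b + 10) ^ 3 \<le> (real b + 45) ^ 3" by (intro power_mono) auto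
  moreover have "card R \<le> card (R \<inter> {(x, y). 0 \<le> s * x}) + card (R \<inter> {(x, y). 0 \<le> - s * x})"
  proof -
    have "R = (R \<inter> {(x, y). 0 \<le> s * x}) \<union> (R \<inter> {(x, y). 0 \<le> - s * x})" by auto
    then show ?thesis using card_Un_le by metis
  qed
  then have "real (card R) \<le> real (card (R \<inter> {(x, y). 0 \<le> s * x})) + 
      real (card (R \<inter> {(x, y). 0 \<le> - s * x}))" by linarith
  ultimately have "9 / 4 * real (card R) \<le> (real b + 45) ^ 3" using b(2) b'(1) by linarith
  with b show ?thesis using that[of b] by blast
qed

end

section \<open>The comb as a rotor-router graph\<close>

lemma comb_degree:
  assumes "rotor_sequences comb_adj c"
  shows "length (c (x, y)) = (if y = 0 then 4 else 2)"
proof -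
  have "set (c (x, y)) =
      (if y = 0 then {(x, 1), (x, - 1), (x + 1, 0), (x - 1, 0)} else {(x, y + 1), (x, y - 1)})"
    using assms by (auto simp: rotor_sequences_def split: if_splits)
  moreover have "length (c (x, y)) = card (set (c (x, y)))"
    using rotor_sequencesD(1)[OF assms] by (simp add: distinct_card)
  ultimately show ?thesis by (simp split: if_splits)
qed

lemma comb_reaches_outside:
  assumes "finite R"
  shows "\<exists>w. comb_adj\<^sup>*\<^sup>* v w \<and> w \<notin> R"
proof -
  obtain x y where v: "v = (x, y)" by force
  have reach: "comb_adj\<^sup>*\<^sup>* (x, y) (x, y + int k)" for k
  proof (induction k)
    case (Suc k)
    have "comb_adj (x, y + int k) (x, y + int (Suc k))" by simp
    with Suc show ?case by (rule rtranclp.rtrancl_into_rtrancl)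
  qed simp
  have "inj (\<lambda>k. (x, y + int k))" by (auto simp: inj_on_def)
  then have "infinite (range (\<lambda>k. (x, y + int k)))"
    by (simp add: finite_image_iff)
  then obtain k where "(x, y + int k) \<notin> R"
    using assms by (metis (no_types, lifting) finite_subset image_subsetI)
  with reach v show ?thesis by blast
qed

lemma tooth_cut:
  assumes "t \<in> {1, - 1 :: int}"
  shows "one_edge_cut comb_adj {(x', y). x' = x \<and> int j < t * y} (x, t * int j) (x, t * int (Suc j))"
    (is "one_edge_cut _ ?A ?z ?w")
proof -
  have "(p \<notin> ?A \<and> p' \<in> ?A \<longrightarrow> p = ?z \<and> p' = ?w) \<and> (p \<in> ?A \<and> p' \<notin> ?A \<longrightarrow> p = ?w \<and> p' = ?z)"
    if adj: "comb_adj p p'" for p p'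
  proof -
    obtain a b a' b' where p: "p = (a, b)" "p' = (a', b')" by (metis prod.exhaust)
    from adj have "(a' = a \<and> (b' = b + 1 \<or> b' = b - 1)) \<or> 
        (b = 0 \<and> b' = 0 \<and> (a' = a + 1 \<or> a' = a - 1))"
      unfolding p comb_adj.simps by linarith
    then show ?thesis
      using assms unfolding p by (elim disjE conjE insertE emptyE; simp; linarith)
  qed
  moreover have "?z \<notin> ?A" "?w \<in> ?A" "comb_adj ?z ?w" "comb_adj ?w ?z"
    using assms by auto
  ultimately show ?thesis unfolding one_edge_cut_def by blast
qed

lemma spine_cut:
  assumes "s \<in> {1, - 1 :: int}"
  shows "one_edge_cut comb_adj {(x, y). int i < s * x} (s * int i, 0) (s * int (Suc i), 0)"
    (is "one_edge_cut _ ?A ?z ?w")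
proof -
  have "(p \<notin> ?A \<and> p' \<in> ?A \<longrightarrow> p = ?z \<and> p' = ?w) \<and> (p \<in> ?A \<and> p' \<notin> ?A \<longrightarrow> p = ?w \<and> p' = ?z)"
    if adj: "comb_adj p p'" for p p'
  proof -
    obtain a b a' b' where p: "p = (a, b)" "p' = (a', b')" by (metis prod.exhaust)
    from adj have "(a' = a \<and> (b' = b + 1 \<or> b' = b - 1)) \<or> 
        (b = 0 \<and> b' = 0 \<and> (a' = a + 1 \<or> a' = a - 1))"
      unfolding p comb_adj.simps by linarith
    then show ?thesis
      using assms unfolding p by (elim disjE conjE insertE emptyE; simp; linarith)
  qed
  moreover have "?z \<notin> ?A" "?w \<in> ?A" "comb_adj ?z ?w" "comb_adj ?w ?z"
    using assms by auto
  ultimately show ?thesis unfolding one_edge_cut_def by blast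
qed

lemma comb_flow_cluster:
  assumes c: "rotor_sequences comb_adj c" and \<rho>: "rotor_configuration comb_adj \<rho>" and "1 \<le> n"
  shows "\<exists>u. comb_flow (cluster c (0, 0) \<rho> n) u"
    and "card (cluster c (0, 0) \<rho> n) = n"
proof -
  obtain m where n: "n = Suc m" using \<open>1 \<le> n\<close> by (cases n) auto
  obtain R \<rho>' where agg: "aggregation c (0, 0) \<rho> n = (R, \<rho>')" by force
  have cl: "cluster c (0, 0) \<rho> n = R" by (simp add: cluster_def agg)
  from aggregation_invariant[OF c \<rho> comb_reaches_outside, where a = "(0, 0)" and n = m] agg n
  obtain u where R: "finite R" "card R = n" "(0, 0) \<in> R"
    and odo: "aggregation_odometer comb_adj c (0, 0) \<rho> R \<rho>' u" by auto
  show "card (cluster c (0, 0) \<rho> n) = n" using cl R(2) by simp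
  note deg = comb_degree[OF c]
  have "comb_flow R u"
  proof
    show "finite R" "(0, 0) \<in> R" by fact+
    show "z \<in> R" if "0 < u z" for z
      using odo that unfolding aggregation_odometer_def by blast
  next
    fix t x :: int and j :: nat assume t: "t \<in> {1, - 1}"
    have o: "(0, 0) \<notin> {(x', y). x' = x \<and> int j < t * y}" for j by simp
    note flow = flow_near_odometer_difference[OF c \<rho> odo tooth_cut[OF t] o]
    show "(x, t * int j) \<in> R" if "(x, t * int (Suc j)) \<in> R"
      using cut_source_in_cluster[OF odo tooth_cut[OF t] o R(1) that] t by auto
    show "\<bar>real (u (x, 0)) / 4 - real (u (x, t)) / 2 -
        real (card (R \<inter> {(x', y). x' = x \<and> 0 < t * y}))\<bar> \<le> 2"
      using flow[of 0] t by (auto simp: deg)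
    show "\<bar>real (u (x, t * int j)) / 2 - real (u (x, t * int (Suc j))) / 2 -
        real (card (R \<inter> {(x', y). x' = x \<and> int j < t * y}))\<bar> \<le> 2" if "1 \<le> j"
    proof -
      have "t * int j \<noteq> 0" "t * int (Suc j) \<noteq> 0" using t that by auto
      then show ?thesis using flow[of j] by (simp only: deg if_False of_nat_numeral)
    qed
  next
    fix s :: int and i :: nat assume s: "s \<in> {1, - 1}"
    have o: "(0, 0) \<notin> {(x, y :: int). int i < s * x}" by simp
    show "(s * int i, 0) \<in> R" if "(s * int (Suc i), 0) \<in> R"
      using cut_source_in_cluster[OF odo spine_cut[OF s] o R(1) that] s by auto
    show "\<bar>real (u (s * int i, 0)) / 4 - real (u (s * int (Suc i), 0)) / 4 -
        real (card (R \<inter> {(x, y). int i < s * x}))\<bar> \<le> 2"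
      using flow_near_odometer_difference[OF c \<rho> odo spine_cut[OF s] o]
      by (simp only: deg if_True of_nat_numeral simp_thms)
  qed
  then show "\<exists>u. comb_flow (cluster c (0, 0) \<rho> n) u" using cl by blast
qed

section \<open>The inner bound\<close>

lemma comb_k_cube_eq: "comb_k ^ 3 = 9 / 4"
proof -
  have "comb_k ^ 3 = (3 / 2) powr (2 / 3 * 3)"
    unfolding comb_k_def by (simp add: powr_power)
  then show ?thesis by (simp add: power2_eq_square)
qed

lemma comb_k_bounds: "0 < comb_k" "comb_k \<le> 2"
proof -
  show "0 < comb_k" by (simp add: comb_k_def)
  have "comb_k ^ 3 \<le> 2 ^ 3" by (simp add: comb_k_cube_eq)
  then show "comb_k \<le> 2" by (rule power_le_imp_le_base[of _ 2, simplified]) simp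
qed

lemma comb_l_eq: "comb_l = comb_k\<^sup>2 / 3"
proof -
  have "comb_k\<^sup>2 = (3 / 2 :: real) powr (1 + 1 / 3)"
    unfolding comb_k_def by (simp add: powr_power)
  also have "\<dots> = 3 / 2 * (3 / 2) powr (1 / 3)" by (subst powr_add) simp
  finally show ?thesis by (simp add: comb_l_def)
qed

lemma comb_k_cube: "(comb_k * real n powr (1 / 3)) ^ 3 = 9 / 4 * real n"
proof -
  have "(real n powr (1 / 3)) ^ 3 = real n" by (cases "n = 0") (simp_all add: powr_power)
  then show ?thesis by (simp add: power_mult_distrib comb_k_cube_eq)
qed

text \<open>
  The constant \<open>71 = 45 + 26\<close> adds up the loss in the length of the spine and the start of the
  lower bound for the heights. Replacing \<open>(D - 71)\<^sup>2\<close> by \<open>D\<^sup>2\<close>, where \<open>D \<le> k N\<close>, costs at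
  most \<open>142 k N\<close>, and a third of it is at most \<open>100 N\<close> because \<open>k \<le> 2\<close>.
\<close>
lemma (in comb_flow) inner_set_subset:
  assumes n: "n = card R" 
  shows "inner_set 71 0 100 n \<subseteq> R"
proof
  fix p assume p: "p \<in> inner_set 71 0 100 n"
  obtain x y where xy: "p = (x, y)" by force
  define N where "N = real n powr (1 / 3)"
  have "n \<noteq> 0" using n origin_in_R finite_R by auto
  then have "1 \<le> real n powr (1 / 6)" "0 \<le> N" by (simp_all add: ge_one_powr_ge_zero N_def)
  then have px: "\<bar>real_of_int x\<bar> \<le> comb_k * N - 71"
    and py: "\<bar>real_of_int y\<bar> \<le> comb_l * (N - \<bar>real_of_int x\<bar> / comb_k)\<^sup>2 - 100 * N"
    using p by (auto simp: inner_set_def xy N_def)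
  define s i where "s = (if 0 \<le> x then 1 else - 1 :: int)" and "i = nat \<bar>x\<bar>"
  define t j where "t = (if 0 \<le> y then 1 else - 1 :: int)" and "j = nat \<bar>y\<bar>"
  have s: "s \<in> {1, - 1}" and x: "x = s * int i" "\<bar>real_of_int x\<bar> = real i"
    by (auto simp: s_def i_def)
  have t: "t \<in> {1, - 1}" and y: "y = t * int j" "\<bar>real_of_int y\<bar> = real j"
    by (auto simp: t_def j_def)
  obtain b where b: "\<And>i. (s * int i, 0) \<in> R \<longleftrightarrow> i \<le> b"
    "9 / 4 * real (card R) \<le> (real b + 45) ^ 3"
    "\<And>i. i + 26 \<le> b \<Longrightarrow> (real b - real i - 26)\<^sup>2 / 3 + 9 \<le> ideal_height (s * int i)"
    using cluster_size_le[OF s] by blast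
  have "(comb_k * N) ^ 3 \<le> (real b + 45) ^ 3"
    using b(2) comb_k_cube[of n] n by (simp add: N_def)
  then have Nb: "comb_k * N \<le> real b + 45" by (rule power_le_imp_le_base[of _ 2, simplified]) simp
  have ib: "i + 26 \<le> b" using Nb px x by linarith
  show "p \<in> R"
  proof (cases j)
    case 0
    then show ?thesis using b(1)[of i] ib x y xy by simp
  next
    case (Suc j')
    obtain h where h: "\<And>j. (x, t * int (Suc j)) \<in> R \<longleftrightarrow> j < h" "\<bar>ideal_height x - real h\<bar> \<le> 4"
      using tooth_height[OF t, of x] by blast
    define D where "D = comb_k * N - real i"
    have D: "71 \<le> D" "D \<le> comb_k * N" using px x by (simp_all add: D_def)
    have "(D - 71)\<^sup>2 \<le> (real b - real i - 26)\<^sup>2"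
      using D Nb by (intro power_mono) (auto simp: D_def)
    then have "(D - 71)\<^sup>2 / 3 \<le> real h"
      using b(3)[OF ib] h(2) x by simp
    moreover have "D\<^sup>2 - 142 * D \<le> (D - 71)\<^sup>2" by (simp add: power2_eq_square algebra_simps)
    ultimately have "D\<^sup>2 / 3 - 142 / 3 * (comb_k * N) \<le> real h" using D(2) by linarith
    moreover have "142 / 3 * (comb_k * N) \<le> 100 * N"
    proof -
      have "142 / 3 * comb_k \<le> 100" using comb_k_bounds by simp
      then show ?thesis using \<open>0 \<le> N\<close> by (metis mult.assoc mult_right_mono)
    qed
    moreover have "comb_l * (N - real i / comb_k)\<^sup>2 = D\<^sup>2 / 3"
    proof -
      have "D = comb_k * (N - real i / comb_k)"
        using comb_k_bounds by (simp add: D_def field_simps)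
      then show ?thesis by (simp add: comb_l_eq power_mult_distrib)
    qed
    ultimately have "real j \<le> real h" using py unfolding x(2) y(2) by linarith
    then show ?thesis using h(1)[of j'] Suc y xy by simp
  qed
qed

theorem theorem5p3:
  "\<exists>c1 c2 c3 :: real. \<exists>n0 :: nat. \<forall>n \<ge> n0. \<forall>c \<rho>.
     rotor_sequences comb_adj c \<longrightarrow> rotor_configuration comb_adj \<rho> \<longrightarrow>
     inner_set c1 c2 c3 n \<subseteq> cluster c (0, 0) \<rho> n"
proof -
  have "inner_set 71 0 100 n \<subseteq> cluster c (0, 0) \<rho> n"
    if prems: "1 \<le> n" "rotor_sequences comb_adj c" "rotor_configuration comb_adj \<rho>" for n c \<rho>
  proof -
    obtain u where "comb_flow (cluster c (0, 0) \<rho> n) u"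
      using comb_flow_cluster(1)[OF prems(2,3,1)] by blast
    then show ?thesis
      by (rule comb_flow.inner_set_subset) (use comb_flow_cluster(2)[OF prems(2,3,1)] in simp)
  qed
  then show ?thesis by blast
qed

end
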